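(* Let $(\Omega,\mathcal{F},\mathbb{P})$ be a probability space, let $X$ be a random element of a standard Borel space $(E_X,\mathcal{E}_X)$ and $Y$ a random element of a measurable space $(E_Y,\mathcal{E}_Y)$, both defined on $\Omega$. Suppose there exist $\sigma$-finite measures $\mu$ on $(E_X,\mathcal{E}_X)$ and $\nu$ on $(E_Y,\mathcal{E}_Y)$ such that the random element $(X,Y)$ has a density $p_{X,Y}:E_X\times E_Y\to[0,\infty)$ with respect to the product measure $\mu\otimes\nu$. Let $p_X:E_X\to[0,\infty)$ denote (a version of) the marginal density of $X$ with respect to $\mu$. Then the function $p_{X|Y}:E_X\times E_Y\to[0,\infty)$ defined by $$p_{X|Y}(x|y)=\begin{cases}\dfrac{p_{X,Y}(x,y)}{\int_{E_X}p_{X,Y}(x',y)\,d\mu(x')}, & \text{when the denominator is non-zero and finite},\\[2mm] p_X(x), & \text{otherwise},\end{cases}$$ is a version of the conditional density of $X$ given $Y$ with respect to $\mu$.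
   Context: Densities. A density of a probability measure $\rho$ on a measurable space $(S,\mathcal{S})$ with respect to a $\sigma$-finite measure $m$ on $(S,\mathcal{S})$ is a measurable function $f:S\to[0,\infty)$ with $\rho(A)=\int_A f\,dm$ for all $A\in\mathcal{S}$ (a Radon--Nikodym derivative of $\rho$ with respect to $m$). A density of a random element is a density of its distribution. In particular, $p_{X,Y}$ is $(\mathcal{E}_X\otimes\mathcal{E}_Y)$-measurable. Conditional probability. For an event $A\in\mathcal{F}$, $\mathbb{P}(A|Y)$ denotes (a version of) the conditional expectation $\mathbb{E}[\mathbf{1}_A|\sigma(Y)]$, where $\sigma(Y)$ is the $\sigma$-algebra generated by $Y$. Conditional distribution. A version of the conditional distribution of $X$ given $Y$ is a map $\kappa:E_Y\times\mathcal{E}_X\to[0,1]$ such that: (i) $\kappa(y,\cdot)$ is a probability measure on $(E_X,\mathcal{E}_X)$ for each fixed $y\in E_Y$; (ii) $\kappa(\cdot,B)$ is $\mathcal{E}_Y$-measurable for each fixed $B\in\mathcal{E}_X$; (iii) $\kappa(Y,\cdot)=\mathbb{P}(X\in\cdot\,|Y)$ almost surely, meaning that for each $B\in\mathcal{E}_X$, $\kappa(Y,B)=\mathbb{P}(X\in B\,|\,Y)$ almost surely. Conditional density. A function $p_{X|Y}:E_X\times E_Y\to[0,\infty)$ is a version of the conditional density of $X$ given $Y$ with respect to a $\sigma$-finite measure $\mu$ on $(E_X,\mathcal{E}_X)$ if it is $(\mathcal{E}_X\otimes\mathcal{E}_Y)$-measurable and $\kappa(y,B)=\int_B p_{X|Y}(x|y)\,d\mu(x)$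 (for $y\in E_Y$, $B\in\mathcal{E}_X$) defines a version of the conditional distribution of $X$ given $Y$. *)

theory Defs
  imports "HOL-Probability.Probability"
begin

text \<open>Measurable spaces are given as values of type \<open>measure\<close>, of which only
  \<open>space\<close> and \<open>sets\<close> are used.\<close>

text \<open>\<open>M\<close> carries the Borel \<open>\<sigma>\<close>-algebra of some Polish topology on its underlying set.\<close>

definition standard_borel_space :: "'a measure \<Rightarrow> bool" where
  "standard_borel_space M \<longleftrightarrow>
     (\<exists>T. completely_metrizable_space T \<and> separable_space T \<and> topspace T = space M
        \<and> sets M = sigma_sets (topspace T) {U. openin T U})"

definition is_density :: "'a measure \<Rightarrow> 'a measure \<Rightarrow> ('a \<Rightarrow> real) \<Rightarrow> bool" where
  "is_density \<rho> m f \<longleftrightarrow>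
     prob_space \<rho> \<and> sigma_finite_measure m \<and> sets \<rho> = sets m
     \<and> f \<in> borel_measurable m \<and> (\<forall>x\<in>space m. 0 \<le> f x)
     \<and> (\<forall>A\<in>sets m. emeasure \<rho> A = (\<integral>\<^sup>+x\<in>A. ennreal (f x) \<partial>m))"

definition cond_prob_given ::
  "'w measure \<Rightarrow> 'y measure \<Rightarrow> ('w \<Rightarrow> 'y) \<Rightarrow> 'w set \<Rightarrow> 'w \<Rightarrow> real" where
  "cond_prob_given P SY Y A = real_cond_exp P (vimage_algebra (space P) Y SY) (indicator A)"

text \<open>A kernel \<open>\<kappa>(y,B)\<close> is represented by the measure-valued map \<open>\<kappa>\<close>, with
  \<open>\<kappa>(y,B) = measure (\<kappa> y) B\<close>. Values of \<open>\<kappa>\<close> outside \<open>space SY\<close> are irrelevant.\<close>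

definition is_cond_distribution ::
  "'w measure \<Rightarrow> 'x measure \<Rightarrow> 'y measure \<Rightarrow> ('w \<Rightarrow> 'x) \<Rightarrow> ('w \<Rightarrow> 'y) \<Rightarrow> ('y \<Rightarrow> 'x measure) \<Rightarrow> bool"
where
  "is_cond_distribution P SX SY X Y \<kappa> \<longleftrightarrow>
     (\<forall>y\<in>space SY. prob_space (\<kappa> y) \<and> sets (\<kappa> y) = sets SX)
     \<and> (\<forall>B\<in>sets SX. (\<lambda>y. measure (\<kappa> y) B) \<in> borel_measurable SY)
     \<and> (\<forall>B\<in>sets SX. AE \<omega> in P.
           measure (\<kappa> (Y \<omega>)) B = cond_prob_given P SY Y (X -` B \<inter> space P) \<omega>)"

definition is_cond_density ::
  "'w measure \<Rightarrow> 'x measure \<Rightarrow> 'y measure \<Rightarrow> ('w \<Rightarrow> 'x) \<Rightarrow> ('w \<Rightarrow> 'y) \<Rightarrow> 'x measure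
    \<Rightarrow> ('x \<times> 'y \<Rightarrow> real) \<Rightarrow> bool" where
  "is_cond_density P SX SY X Y \<mu> p \<longleftrightarrow>
     sigma_finite_measure \<mu> \<and> sets \<mu> = sets SX
     \<and> p \<in> borel_measurable (SX \<Otimes>\<^sub>M SY) \<and> (\<forall>z\<in>space (SX \<Otimes>\<^sub>M SY). 0 \<le> p z)
     \<and> is_cond_distribution P SX SY X Y (\<lambda>y. density \<mu> (\<lambda>x. ennreal (p (x, y))))"

definition cond_density_formula ::
  "'x measure \<Rightarrow> ('x \<times> 'y \<Rightarrow> real) \<Rightarrow> ('x \<Rightarrow> real) \<Rightarrow> 'x \<times> 'y \<Rightarrow> real" where
  "cond_density_formula \<mu> pXY pX = (\<lambda>(x, y).
     let d = (\<integral>\<^sup>+x'. ennreal (pXY (x', y)) \<partial>\<mu>)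
     in if d \<noteq> 0 \<and> d \<noteq> \<infinity> then pXY (x, y) / enn2real d else pX x)"

end

theory Submission
  imports Defs
begin

text \<open>Put \<open>d(y) = \<integral>p(x, y) d\<mu>(x)\<close>. By Tonelli, \<open>d\<close> is a density of \<open>Y\<close> with respect to \<open>\<nu>\<close>
  and has integral \<open>1\<close>, so \<open>d < \<infinity>\<close> \<open>\<nu>\<close>-almost everywhere. Where \<open>d(y) < \<infinity>\<close>, we have
  \<open>\<kappa>(y, B) d(y) = \<integral>\<^sub>B p(x, y) d\<mu>(x)\<close>, since both sides vanish if \<open>d(y) = 0\<close>. Integrating this
  over \<open>y \<in> C\<close> gives \<open>P(X \<in> B, Y \<in> C)\<close>, which characterizes the conditional probability.\<close>

text \<open>\<open>real_cond_exp\<close> is a difference of two terms, obtained from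
  \<open>nn_cond_exp\<close> of the positive and of the negative part. An indicator has negative
  part 0, so uniqueness of \<open>nn_cond_exp\<close> settles both terms. With \<open>g\<close>
  valued in \<open>ennreal\<close>, no integrability has to be checked.\<close>

lemma (in sigma_finite_subalgebra) real_cond_exp_indicator_charact:
  assumes E[measurable]: "E \<in> sets M"
    and g[measurable]: "g \<in> borel_measurable F"
    and eq: "\<And>A. A \<in> sets F \<Longrightarrow> emeasure M (E \<inter> A) = (\<integral>\<^sup>+\<omega>\<in>A. g \<omega> \<partial>M)"
  shows "AE \<omega> in M. real_cond_exp M F (indicator E) \<omega> = enn2real (g \<omega>)"
proof -
  have "AE \<omega> in M. g \<omega> = nn_cond_exp M F (\<lambda>\<omega>. ennreal (indicator E \<omega>)) \<omega>"
  proof (rule nn_cond_exp_charact)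
    fix A assume A: "A \<in> sets F"
    then have [measurable]: "A \<in> sets M" using subalg by (auto simp: subalgebra_def)
    have "(\<integral>\<^sup>+\<omega>\<in>A. ennreal (indicator E \<omega>) \<partial>M) = (\<integral>\<^sup>+\<omega>. indicator (E \<inter> A) \<omega> \<partial>M)"
      by (intro nn_integral_cong) (auto split: split_indicator)
    then show "(\<integral>\<^sup>+\<omega>\<in>A. ennreal (indicator E \<omega>) \<partial>M) = (\<integral>\<^sup>+\<omega>\<in>A. g \<omega> \<partial>M)"
      using eq[OF A] by simp
  qed auto
  moreover have "AE \<omega> in M. (0::ennreal) = nn_cond_exp M F (\<lambda>\<omega>. ennreal (- indicator E \<omega>)) \<omega>"
    by (rule nn_cond_exp_charact) (auto simp: ennreal_neg)
  ultimately show ?thesis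
  proof eventually_elim
    case (elim \<omega>)
    from elim(2) show ?case
      unfolding real_cond_exp_def elim(1)[symmetric] elim(2)[symmetric] by simp
  qed
qed

text \<open>Every set of the sigma-algebra generated by \<open>Y\<close> is the preimage of some
  \<open>C\<close>, so a change of variables lets the defining property of the conditional
  expectation be tested by integrals against the law of \<open>Y\<close>.\<close>

lemma vimage_algebra_real_cond_exp_indicator_charact:
  assumes "finite_measure M" and Y[measurable]: "Y \<in> measurable M N"
    and E: "E \<in> sets M" and h[measurable]: "h \<in> borel_measurable N"
    and eq: "\<And>C. C \<in> sets N \<Longrightarrow> emeasure M (E \<inter> Y -` C) = (\<integral>\<^sup>+y\<in>C. h y \<partial>distr M N Y)"
  shows "AE \<omega> in M. real_cond_exp M (vimage_algebra (space M) Y N) (indicator E) \<omega>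
    = enn2real (h (Y \<omega>))"
proof -
  let ?F = "vimage_algebra (space M) Y N"
  have Ysp: "Y \<in> space M \<rightarrow> space N" using measurable_space[OF Y] by auto
  \<comment> \<open>Finiteness of \<open>M\<close> passes to the restriction to \<open>?F\<close>,
    which provides the sigma-finiteness that conditional expectations require.\<close>
  have "subalgebra M ?F"
    using sets_image_in_sets[OF refl, of Y M N] Y by (auto simp: subalgebra_def)
  then have "finite_measure_subalgebra M ?F"
    using assms(1) by (simp add: finite_measure_subalgebra_def finite_measure_subalgebra_axioms_def)
  then interpret finite_measure_subalgebra M ?F .
  show ?thesis
  proof (rule real_cond_exp_indicator_charact[OF E])
    show "(\<lambda>\<omega>. h (Y \<omega>)) \<in> borel_measurable ?F"
      by (rule measurable_compose[OF measurable_vimage_algebra1[OF Ysp] h])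
    fix A assume "A \<in> sets ?F"
    then obtain C where C[measurable]: "C \<in> sets N" and A: "A = Y -` C \<inter> space M"
      using Ysp by (auto simp: sets_vimage_algebra2)
    \<comment> \<open>The factor \<open>space M\<close> in \<open>A\<close> is absorbed by
      \<open>E\<close>.\<close>
    have "E \<inter> A = E \<inter> Y -` C" using A sets.sets_into_space[OF E] by auto
    then have "emeasure M (E \<inter> A) = (\<integral>\<^sup>+y\<in>C. h y \<partial>distr M N Y)" using eq[OF C] by simp
    also have "\<dots> = (\<integral>\<^sup>+\<omega>. h (Y \<omega>) * indicator C (Y \<omega>) \<partial>M)"
      by (rule nn_integral_distr) measurable
    also have "\<dots> = (\<integral>\<^sup>+\<omega>\<in>A. h (Y \<omega>) \<partial>M)"
      by (intro nn_integral_cong) (auto simp: A split: split_indicator)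
    finally show "emeasure M (E \<inter> A) = (\<integral>\<^sup>+\<omega>\<in>A. h (Y \<omega>) \<partial>M)" .
  qed
qed

lemma measurable_cond_density_formula:
  assumes "sigma_finite_measure \<mu>"
    and [measurable]: "p \<in> borel_measurable (\<mu> \<Otimes>\<^sub>M N)" "q \<in> borel_measurable \<mu>"
  shows "cond_density_formula \<mu> p q \<in> borel_measurable (\<mu> \<Otimes>\<^sub>M N)"
proof -
  interpret sigma_finite_measure \<mu> by fact
  show ?thesis unfolding cond_density_formula_def Let_def by measurable
qed

text \<open>For fixed \<open>y\<close> the denominator is a constant in the open interval from 0 to
  \<infinity>, so it can be pulled out of the integral over \<open>B\<close>.\<close>

lemma nn_integral_cond_density_formula:
  assumes p: "(\<lambda>x. p (x, y)) \<in> borel_measurable \<mu>" and B: "B \<in> sets \<mu>"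
    and d: "(\<integral>\<^sup>+x. ennreal (p (x, y)) \<partial>\<mu>) \<noteq> 0" "(\<integral>\<^sup>+x. ennreal (p (x, y)) \<partial>\<mu>) \<noteq> \<infinity>"
  shows "(\<integral>\<^sup>+x\<in>B. ennreal (cond_density_formula \<mu> p q (x, y)) \<partial>\<mu>)
    = (\<integral>\<^sup>+x\<in>B. ennreal (p (x, y)) \<partial>\<mu>) / (\<integral>\<^sup>+x. ennreal (p (x, y)) \<partial>\<mu>)"
proof -
  let ?d = "\<integral>\<^sup>+x. ennreal (p (x, y)) \<partial>\<mu>"
  note [measurable] = p B
  have pos: "enn2real ?d > 0" using d
    by (simp add: enn2real_positive_iff less_top zero_less_iff_neq_zero)
  have "ennreal (cond_density_formula \<mu> p q (x, y)) = ennreal (p (x, y)) / ?d" for x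
  proof -
    have "ennreal (p (x, y) / enn2real ?d) = ennreal (p (x, y)) / ennreal (enn2real ?d)"
    \<comment> \<open>\<open>divide_ennreal\<close> wants a nonnegative numerator; for a negative
      one, \<open>ennreal\<close> truncates both sides to 0.\<close>
    proof (cases "0 \<le> p (x, y)")
      case True
      then show ?thesis using pos by (rule divide_ennreal[symmetric])
    next
      case False
      then show ?thesis using pos by (simp add: ennreal_neg divide_nonpos_pos)
    qed
    then show ?thesis using d by (simp add: cond_density_formula_def Let_def less_top)
  qed
  then have "(\<integral>\<^sup>+x\<in>B. ennreal (cond_density_formula \<mu> p q (x, y)) \<partial>\<mu>)
    = (\<integral>\<^sup>+x. (ennreal (p (x, y)) * indicator B x) / ?d \<partial>\<mu>)"
    by (intro nn_integral_cong) (auto split: split_indicator)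
  also have "\<dots> = (\<integral>\<^sup>+x\<in>B. ennreal (p (x, y)) \<partial>\<mu>) / ?d"
    by (rule nn_integral_divide) measurable
  finally show ?thesis .
qed

theorem proposition4:
  fixes P :: "'w measure" and SX :: "'x measure" and SY :: "'y measure"
    and X :: "'w \<Rightarrow> 'x" and Y :: "'w \<Rightarrow> 'y"
    and \<mu> :: "'x measure" and \<nu> :: "'y measure"
    and pXY :: "'x \<times> 'y \<Rightarrow> real" and pX :: "'x \<Rightarrow> real"
  assumes "prob_space P"
    and "standard_borel_space SX"
    and "X \<in> measurable P SX" and "Y \<in> measurable P SY"
    and "sigma_finite_measure \<mu>" and "sets \<mu> = sets SX"
    and "sigma_finite_measure \<nu>" and "sets \<nu> = sets SY"
    and "is_density (distr P (SX \<Otimes>\<^sub>M SY) (\<lambda>\<omega>. (X \<omega>, Y \<omega>))) (\<mu> \<Otimes>\<^sub>M \<nu>) pXY"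
    and "is_density (distr P SX X) \<mu> pX"
  shows "is_cond_density P SX SY X Y \<mu> (cond_density_formula \<mu> pXY pX)"
proof -
  interpret P: prob_space P by fact
  interpret M: sigma_finite_measure \<mu> by fact
  interpret N: sigma_finite_measure \<nu> by fact
  interpret MN: pair_sigma_finite \<mu> \<nu> ..
  \<comment> \<open>This makes \<mu> and \<open>SX\<close>, and likewise \<nu> and
    \<open>SY\<close>, interchangeable in measurability proofs.\<close>
  note [measurable_cong] = assms(6,8)
  note X[measurable] = assms(3) and Y[measurable] = assms(4)
  have spX: "space \<mu> = space SX" and spY: "space \<nu> = space SY"
    using assms(6,8) by (auto dest: sets_eq_imp_space_eq)
  have pair: "sets (SX \<Otimes>\<^sub>M SY) = sets (\<mu> \<Otimes>\<^sub>M \<nu>)"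
    using assms(6,8) by (intro sets_pair_measure_cong) auto
  from assms(9) have pXY[measurable]: "pXY \<in> borel_measurable (\<mu> \<Otimes>\<^sub>M \<nu>)"
    and pXY_nonneg: "\<And>z. z \<in> space (\<mu> \<Otimes>\<^sub>M \<nu>) \<Longrightarrow> 0 \<le> pXY z"
    and pXY_dens: "\<And>A. A \<in> sets (\<mu> \<Otimes>\<^sub>M \<nu>) \<Longrightarrow>
      emeasure (distr P (SX \<Otimes>\<^sub>M SY) (\<lambda>\<omega>. (X \<omega>, Y \<omega>))) A = (\<integral>\<^sup>+z\<in>A. ennreal (pXY z) \<partial>(\<mu> \<Otimes>\<^sub>M \<nu>))"
    by (auto simp: is_density_def)
  from assms(10) have pX[measurable]: "pX \<in> borel_measurable \<mu>"
    and pX_nonneg: "\<And>x. x \<in> space \<mu> \<Longrightarrow> 0 \<le> pX x"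
    and pX_prob: "prob_space (distr P SX X)"
    and pX_dens: "\<And>A. A \<in> sets \<mu> \<Longrightarrow>
      emeasure (distr P SX X) A = (\<integral>\<^sup>+x\<in>A. ennreal (pX x) \<partial>\<mu>)"
    by (auto simp: is_density_def)
  define p where "p = cond_density_formula \<mu> pXY pX"
  define d where "d y = (\<integral>\<^sup>+x. ennreal (pXY (x, y)) \<partial>\<mu>)" for y
  \<comment> \<open>The candidate kernel with values in \<open>ennreal\<close>; it is turned into a
    real number only when compared with \<open>measure\<close>.\<close>
  define k where "k B y = (\<integral>\<^sup>+x\<in>B. ennreal (p (x, y)) \<partial>\<mu>)" for B y
  have p[measurable]: "p \<in> borel_measurable (\<mu> \<Otimes>\<^sub>M \<nu>)"
    unfolding p_def by (rule measurable_cond_density_formula) (use assms(5) in measurable)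
  have d[measurable]: "d \<in> borel_measurable \<nu>" unfolding d_def by measurable
  have k[measurable]: "k B \<in> borel_measurable \<nu>" if [measurable]: "B \<in> sets \<mu>" for B
    unfolding k_def by measurable
  have pXY_y: "(\<lambda>x. pXY (x, y)) \<in> borel_measurable \<mu>" if "y \<in> space \<nu>" for y
    by (rule measurable_Pair1[OF pXY that])
  have dens_k: "emeasure (density \<mu> (\<lambda>x. ennreal (p (x, y)))) B = k B y"
    if y: "y \<in> space \<nu>" and B: "B \<in> sets \<mu>" for y B
    unfolding k_def
    by (rule emeasure_density[OF measurable_compose[OF measurable_Pair1[OF p y] measurable_ennreal] B])
  \<comment> \<open>The joint law on rectangles, with the integral over \<open>x\<close> inside. It
    serves twice: with \<open>B\<close> the whole space it yields the law of \<open>Y\<close>, and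
    for general \<open>B\<close> it yields the conditional probability.\<close>
  have rect: "emeasure P (X -` B \<inter> Y -` C \<inter> space P)
      = (\<integral>\<^sup>+y\<in>C. (\<integral>\<^sup>+x\<in>B. ennreal (pXY (x, y)) \<partial>\<mu>) \<partial>\<nu>)"
    if B[measurable]: "B \<in> sets \<mu>" and C[measurable]: "C \<in> sets \<nu>" for B C
  proof -
    have "X -` B \<inter> Y -` C \<inter> space P = (\<lambda>\<omega>. (X \<omega>, Y \<omega>)) -` (B \<times> C) \<inter> space P" by auto
    then have "emeasure P (X -` B \<inter> Y -` C \<inter> space P)
        = emeasure (distr P (SX \<Otimes>\<^sub>M SY) (\<lambda>\<omega>. (X \<omega>, Y \<omega>))) (B \<times> C)"
      by (simp add: emeasure_distr pair)
    also have "\<dots> = (\<integral>\<^sup>+z\<in>B \<times> C. ennreal (pXY z) \<partial>(\<mu> \<Otimes>\<^sub>M \<nu>))"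
      by (rule pXY_dens) measurable
    also have "\<dots> = (\<integral>\<^sup>+y. \<integral>\<^sup>+x. ennreal (pXY (x, y)) * indicator (B \<times> C) (x, y) \<partial>\<mu> \<partial>\<nu>)"
      by (rule MN.nn_integral_snd[symmetric]) measurable
    also have "\<dots> = (\<integral>\<^sup>+y\<in>C. (\<integral>\<^sup>+x\<in>B. ennreal (pXY (x, y)) \<partial>\<mu>) \<partial>\<nu>)"
      by (intro nn_integral_cong) (auto simp: indicator_times split: split_indicator)
    finally show ?thesis .
  qed
  have distr_Y: "distr P SY Y = density \<nu> d"
  proof (rule measure_eqI)
    fix C assume "C \<in> sets (distr P SY Y)"
    then have C: "C \<in> sets SY" by simp
    then have [measurable]: "C \<in> sets \<nu>" by (simp add: assms(8))
    have "X -` space \<mu> \<inter> Y -` C \<inter> space P = Y -` C \<inter> space P"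
      using measurable_space[OF X] by (auto simp: spX)
    moreover have "(\<integral>\<^sup>+x\<in>space \<mu>. ennreal (pXY (x, y)) \<partial>\<mu>) = d y" for y
      unfolding d_def by (intro nn_integral_cong) simp
    ultimately show "emeasure (distr P SY Y) C = emeasure (density \<nu> d) C"
      using rect[of "space \<mu>" C] by (simp add: emeasure_distr[OF Y C] emeasure_density)
  qed (simp add: assms(8))
  have "(\<integral>\<^sup>+y. d y \<partial>\<nu>) = emeasure (distr P SY Y) (space \<nu>)"
    by (simp add: distr_Y emeasure_density cong: nn_integral_cong)
  also have "\<dots> \<noteq> \<infinity>"
    using finite_measure.emeasure_finite[OF prob_space.finite_measure[OF P.prob_space_distr[OF Y]]]
    by simp
  finally have d_fin: "AE y in \<nu>. d y \<noteq> \<infinity>"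
    by (intro nn_integral_noteq_infinite) auto
  have k_good: "k B y = (\<integral>\<^sup>+x\<in>B. ennreal (pXY (x, y)) \<partial>\<mu>) / d y"
    if "y \<in> space \<nu>" "B \<in> sets \<mu>" "d y \<noteq> 0" "d y \<noteq> \<infinity>" for B y
    using that unfolding k_def p_def d_def
    by (intro nn_integral_cond_density_formula pXY_y) auto
  \<comment> \<open>Total mass 1 is required at every \<open>y\<close>, not only almost everywhere.
    On the exceptional set it comes from the fallback \<open>pX\<close>, which is itself a
    probability density.\<close>
  have k_total: "k (space \<mu>) y = 1" if y: "y \<in> space \<nu>" for y
  proof (cases "d y \<noteq> 0 \<and> d y \<noteq> \<infinity>")
    case True
    have "(\<integral>\<^sup>+x\<in>space \<mu>. ennreal (pXY (x, y)) \<partial>\<mu>) = d y"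
      unfolding d_def by (intro nn_integral_cong) simp
    then show ?thesis using True k_good[OF y, of "space \<mu>"] by (simp add: ennreal_divide_self less_top)
  next
    case False
    then have "k (space \<mu>) y = (\<integral>\<^sup>+x\<in>space \<mu>. ennreal (pX x) \<partial>\<mu>)"
      unfolding k_def p_def cond_density_formula_def by (auto simp: d_def Let_def)
    also have "\<dots> = emeasure (distr P SX X) (space (distr P SX X))"
      using pX_dens[of "space \<mu>"] by (simp add: spX)
    finally show ?thesis using prob_space.emeasure_space_1[OF pX_prob] by simp
  qed
  have cond: "AE \<omega> in P. measure (density \<mu> (\<lambda>x. ennreal (p (x, Y \<omega>)))) B
      = cond_prob_given P SY Y (X -` B \<inter> space P) \<omega>" if B: "B \<in> sets SX" for B
  proof -
    have [measurable]: "B \<in> sets \<mu>" using B by (simp add: assms(6))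
    have "AE \<omega> in P. cond_prob_given P SY Y (X -` B \<inter> space P) \<omega> = enn2real (k B (Y \<omega>))"
      unfolding cond_prob_given_def
    proof (rule vimage_algebra_real_cond_exp_indicator_charact)
      fix C assume "C \<in> sets SY"
      then have [measurable]: "C \<in> sets \<nu>" by (simp add: assms(8))
      \<comment> \<open>Integrating against the law of \<open>Y\<close> means weighting by
        \<open>d\<close>, which is what cancels the denominator in \<open>k\<close>.\<close>
      have "(\<integral>\<^sup>+y\<in>C. k B y \<partial>distr P SY Y) = (\<integral>\<^sup>+y. d y * (k B y * indicator C y) \<partial>\<nu>)"
        unfolding distr_Y by (rule nn_integral_density) measurable
      also have "\<dots> = (\<integral>\<^sup>+y\<in>C. (\<integral>\<^sup>+x\<in>B. ennreal (pXY (x, y)) \<partial>\<mu>) \<partial>\<nu>)"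
      proof (rule nn_integral_cong_AE)
        show "AE y in \<nu>. d y * (k B y * indicator C y)
            = (\<integral>\<^sup>+x\<in>B. ennreal (pXY (x, y)) \<partial>\<mu>) * indicator C y"
          \<comment> \<open>Only the null set where \<open>d\<close> is infinite has to be
            discarded: there \<open>k\<close> is given by \<open>pX\<close> and the identity may
            fail.\<close>
          using d_fin AE_space
        proof eventually_elim
          case (elim y)
          have "d y * k B y = (\<integral>\<^sup>+x\<in>B. ennreal (pXY (x, y)) \<partial>\<mu>)"
          \<comment> \<open>If \<open>d y = 0\<close>, the left side is 0 whatever the fallback
            gives, and the right side is bounded by \<open>d y\<close>. Otherwise \<open>d y\<close>
            is nonzero and finite, and it cancels.\<close>
          proof (cases "d y = 0")
            case True
            have "(\<integral>\<^sup>+x\<in>B. ennreal (pXY (x, y)) \<partial>\<mu>) \<le> d y"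
              unfolding d_def by (intro nn_integral_mono) (auto split: split_indicator)
            then show ?thesis using True by simp
          next
            case False
            then show ?thesis using elim
              by (simp add: k_good ennreal_times_divide mult.commute[of "d y"] mult_divide_eq_ennreal)
          qed
          then show ?case by (simp add: mult.assoc[symmetric])
        qed
      qed
      also have "\<dots> = emeasure P (X -` B \<inter> Y -` C \<inter> space P)"
        by (rule rect[symmetric]) measurable
      finally show "emeasure P (X -` B \<inter> space P \<inter> Y -` C) = (\<integral>\<^sup>+y\<in>C. k B y \<partial>distr P SY Y)"
        by (simp add: Int_ac)
    qed (use B in \<open>auto intro: P.finite_measure_axioms\<close>)
    then show ?thesis
      \<comment> \<open>Membership of \<omega> in \<open>space P\<close> puts
        \<open>Y \<omega>\<close> into \<open>space \<nu>\<close>, where \<open>dens_k\<close>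
        identifies the density measure with \<open>k\<close>.\<close>
      using AE_space
    proof eventually_elim
      case (elim \<omega>)
      then have "Y \<omega> \<in> space \<nu>" using measurable_space[OF Y] by (simp add: spY)
      then show ?case using elim by (simp add: measure_def dens_k)
    qed
  qed
  have "is_cond_distribution P SX SY X Y (\<lambda>y. density \<mu> (\<lambda>x. ennreal (p (x, y))))"
    unfolding is_cond_distribution_def
  proof (intro conjI ballI)
    fix y assume "y \<in> space SY"
    then have "y \<in> space \<nu>" by (simp add: spY)
    then show "prob_space (density \<mu> (\<lambda>x. ennreal (p (x, y))))"
      by (intro prob_spaceI) (simp add: dens_k k_total)
  next
    fix B assume "B \<in> sets SX"
    then have [measurable]: "B \<in> sets \<mu>" by (simp add: assms(6))
    \<comment> \<open>Measurability comes from \<open>k\<close> and is carried over to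
      \<open>measure\<close>, since the two functions agree on \<open>space SY\<close>.\<close>
    have "(\<lambda>y. enn2real (k B y)) \<in> borel_measurable SY" by measurable
    then show "(\<lambda>y. measure (density \<mu> (\<lambda>x. ennreal (p (x, y)))) B) \<in> borel_measurable SY"
      by (rule measurable_cong[THEN iffD1, rotated]) (simp add: measure_def dens_k spY)
  qed (auto simp: assms(6) intro: cond)
  moreover have "0 \<le> p z" if "z \<in> space (SX \<Otimes>\<^sub>M SY)" for z
    using that pXY_nonneg pX_nonneg
    by (auto simp: p_def cond_density_formula_def Let_def space_pair_measure spX spY)
  ultimately show ?thesis
    using assms(5,6) p unfolding is_cond_density_def p_def[symmetric]
    by (auto cong: measurable_cong_sets simp: measurable_cong_sets[OF pair refl])
qed

end
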